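(* Let $n$ be a positive integer. Then $$\sum_{\pi\in\mathcal B_{2n+1}}(-1)^{\mathrm{inv}(|\pi|)}t^{\mathrm{fdes}(\pi)} = (1-t^2)^n \sum_{\pi\in\mathcal B_{n+1}}t^{\mathrm{fdes}(\pi)},$$ and $$\sum_{\pi\in\mathcal B_{2n+1}}(-1)^{\ell_B(\pi)}t^{\mathrm{fdes}(\pi)} = (1-t^2)^n(1-t)\sum_{\pi\in\mathcal B_n}t^{2\,\mathrm{des}_B(\pi)}.$$
   Context: For $N\ge1$, $\mathcal B_N$ is the group of signed permutations: words $\pi=\pi_1\pi_2\cdots\pi_N$ with $\pi_i\in\{\pm1,\dots,\pm N\}$ such that $|\pi|:=|\pi_1||\pi_2|\cdots|\pi_N|$ is a permutation of $\{1,\dots,N\}$. Write $\bar i=-i$. $\mathrm{inv}(\pi)=|\{(i,j):i<j,\ \pi_i>\pi_j\}|$ with respect to the natural order $\bar N<\cdots<\bar1<1<\cdots<N$ (so $\mathrm{inv}(|\pi|)$ is the usual inversion number of the permutation $|\pi|$). Type $B$ length: $\ell_B(\pi)=\mathrm{inv}(\pi)-\sum_{i:\,\pi_i<0}\pi_i$. Flag descent number: $\mathrm{fdes}(\pi)=2\,\mathrm{des}_F(\pi)+\delta(\pi_1<0)$, where $\mathrm{des}_F(\pi)=|\{i\in\{1,\dots,N-1\}:\pi_i>\pi_{i+1}\}|$ with respect to the linear order $\bar1<\bar2<\cdots<\bar N<1<2<\cdots<N$, and $\delta(\mathsf A)=1$ if $\mathsf A$ is true and $0$ otherwise. Type $B$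 descent number: $\mathrm{des}_B(\pi)=|\{i:0\le i\le N-1,\ \pi_i>\pi_{i+1}\}|$ with respect to the natural order of integers, with $\pi_0:=0$. $t$ is an indeterminate. *)

theory Defs
  imports "HOL-Computational_Algebra.Polynomial"
begin

text \<open>
  A word \<open>w = w\<^sub>1 \<dots> w\<^sub>N\<close> is a list of integers. List positions start at 0, so
  the letter \<open>w\<^sub>i\<close> is \<open>w ! (i - 1)\<close>.
\<close>

definition signed_perms :: "nat \<Rightarrow> int list set" where
  "signed_perms N = {w. length w = N \<and> distinct (map abs w) \<and> set (map abs w) = {1..int N}}"

definition inv_num :: "int list \<Rightarrow> nat" where
  "inv_num w = card {(i, j). i < j \<and> j < length w \<and> w ! i > w ! j}"

text \<open>The sum below is never positive, so \<open>nat\<close> does not truncate.\<close>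

definition length_B :: "int list \<Rightarrow> nat" where
  "length_B w = nat (int (inv_num w) - (\<Sum>i | i < length w \<and> w ! i < 0. w ! i))"

text \<open>On the nonzero integers this is the order \<open>-1 < -2 < \<dots> < 1 < 2 < \<dots>\<close>.\<close>

definition less_F :: "int \<Rightarrow> int \<Rightarrow> bool" where
  "less_F a b \<longleftrightarrow> (if (a < 0) = (b < 0) then \<bar>a\<bar> < \<bar>b\<bar> else a < 0)"

definition des_F :: "int list \<Rightarrow> nat" where
  "des_F w = card {i. Suc i < length w \<and> less_F (w ! Suc i) (w ! i)}"

definition fdes :: "int list \<Rightarrow> nat" where
  "fdes w = 2 * des_F w + (if hd w < 0 then 1 else 0)"

text \<open>Prepending 0 realises the convention \<open>w\<^sub>0 = 0\<close>: here \<open>w\<^sub>i\<close> is \<open>(0 # w) ! i\<close>.\<close>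

definition des_B :: "int list \<Rightarrow> nat" where
  "des_B w = card {i. i < length w \<and> (0 # w) ! i > (0 # w) ! Suc i}"

abbreviation indet :: "int poly" where
  "indet \<equiv> [:0, 1:]"

lemma finite_signed_perms: "finite (signed_perms N)"
proof (rule finite_subset)
  show "signed_perms N \<subseteq> {w. set w \<subseteq> {- int N..int N} \<and> length w = N}"
  proof
    fix w assume "w \<in> signed_perms N"
    then have len: "length w = N" and S: "abs ` set w = {1..int N}"
      by (auto simp: signed_perms_def)
    have "x \<in> {- int N..int N}" if "x \<in> set w" for x
    proof -
      have "\<bar>x\<bar> \<in> {1..int N}" using that S by blast
      then show ?thesis by auto
    qed
    with len show "w \<in> {w. set w \<subseteq> {- int N..int N} \<and> length w = N}" by auto
  qed
qed (rule finite_lists_length_eq, simp)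

lemma int_length_B:
  "int (length_B w) = int (inv_num w) - (\<Sum>i | i < length w \<and> w ! i < 0. w ! i)"
proof -
  have "(\<Sum>i | i < length w \<and> w ! i < 0. w ! i) \<le> 0"
    by (rule sum_nonpos) auto
  then show ?thesis by (simp add: length_B_def)
qed

end

theory Submission
  imports Defs "HOL-Combinatorics.Transposition"
begin

text \<open>
  Both identities come from one sign-reversing involution, applied to words whose absolute values
  run through an arbitrary finite set of positive letters. Let \<open>p < q\<close> be two letters with no letter
  of the set between them. Exchanging \<open>p\<close> and \<open>q\<close> in a word, while every position keeps its sign,
  changes the parity of the inversion number of the absolute values. It also keeps the flag descent
  number unless \<open>p\<close> and \<open>q\<close> stand next to each other with the same sign, because no other letter
  compares differently with \<open>p\<close> and \<open>q\<close>, and the order of two letters of different sign depends on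
  the signs only. So all words cancel except those in which the
  two letters form a block \<open>\<plusminus>p \<plusminus>q\<close> or \<open>\<plusminus>q \<plusminus>p\<close>. The second kind of block contains one more descent
  and has the opposite sign. Shrinking the block to the single letter \<open>\<plusminus>p\<close> therefore produces the factor
  \<open>1 - t\<^sup>2\<close>, and the block contributes an even number to all remaining statistics, so that afterwards
  \<open>\<plusminus>p\<close> carries no sign at all. This is \<open>contract_pair\<close>.

  Starting from the letters \<open>1, \<dots>, 2n + 1\<close>, the pairs \<open>(2n, 2n + 1), \<dots>, (2, 3)\<close> are contracted in
  this way (\<open>contract_all_pairs\<close>). What is left is the factor \<open>(1 - t\<^sup>2)\<^sup>n\<close> and a sum over the words
  in the \<open>n + 1\<close> letters \<open>1, 2, 4, \<dots>, 2n\<close>, in which only the letter 1 may still carry a sign.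

  For \<open>(-1)\<close> to the power \<open>inv |w|\<close>, a single letter has no inversions, so the remaining sum is the
  generating function of the flag descent number, up to renaming the letters.

  For \<open>(-1)\<close> to the power \<open>length_B\<close>, the sign is \<open>(-1)\<close> to the power \<open>inv |w|\<close> times \<open>-1\<close> for each
  negative letter (\<open>length_B_sign\<close>), so the remaining sum carries the sign of the letter \<open>\<plusminus>1\<close>. Take
  this letter out of the word. For a fixed rest \<open>u\<close>, the sum over all its possible places collapses
  to \<open>(1 - t) t\<^bsup>2d\<^esup>\<close>, where \<open>d\<close> counts the descents of the word \<open>0 u\<close> in the order
  \<open>-1 < -2 < \<dots> < 0 < 1 < 2 < \<dots>\<close> (\<open>sum_insert_one\<close>). That order differs from the natural
  one only by a reversal of the negative letters. Hence \<open>d\<close> is equidistributed with the type B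
  descent number (\<open>sum_des_F_eq_des_B\<close>).
\<close>

section \<open>Inversions\<close>

lemma inv_num_Nil [simp]: "inv_num [] = 0"
  by (simp add: inv_num_def)

lemma inv_num_Cons: "inv_num (a # w) = length (filter (\<lambda>y. y < a) w) + inv_num w"
proof -
  let ?L = "{j. j < length w \<and> w ! j < a}"
  let ?I = "{(i, j). i < j \<and> j < length w \<and> w ! i > w ! j}"
  have split: "{(i, j). i < j \<and> j < length (a # w) \<and> (a # w) ! i > (a # w) ! j}
      = (\<lambda>j. (0, Suc j)) ` ?L \<union> map_prod Suc Suc ` ?I" (is "?lhs = ?rhs")
  proof (rule set_eqI)
    fix x :: "nat \<times> nat"
    obtain i j where x: "x = (i, j)" by (cases x)
    show "x \<in> ?lhs \<longleftrightarrow> x \<in> ?rhs"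
      unfolding x by (cases i; cases j) (auto simp: image_iff)
  qed
  have fin: "finite ?I"
    by (rule finite_subset[of _ "{..<length w} \<times> {..<length w}"]) auto
  have "inv_num (a # w) = card ((\<lambda>j. (0::nat, Suc j)) ` ?L) + card (map_prod Suc Suc ` ?I)"
    unfolding inv_num_def split by (rule card_Un_disjoint) (use fin in auto)
  also have "card ((\<lambda>j. (0::nat, Suc j)) ` ?L) = card ?L"
    by (rule card_image) (auto simp: inj_on_def)
  also have "card (map_prod Suc Suc ` ?I) = inv_num w"
    unfolding inv_num_def by (rule card_image) (auto simp: inj_on_def)
  finally show ?thesis by (simp add: length_filter_conv_card)
qed

lemma length_filter_less_map:
  assumes "\<And>y. y \<in> set w \<Longrightarrow> f y < (c::int) \<longleftrightarrow> y < d"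
  shows "length (filter (\<lambda>y. y < c) (map f w)) = length (filter (\<lambda>y. y < (d::int)) w)"
  using assms by (induction w) auto

lemma inv_num_map:
  assumes "\<And>x y. x \<in> set w \<Longrightarrow> y \<in> set w \<Longrightarrow> f x < f y \<longleftrightarrow> x < y"
  shows "inv_num (map f w) = inv_num w"
  using assms
proof (induction w)
  case (Cons a w)
  have "length (filter (\<lambda>y. y < f a) (map f w)) = length (filter (\<lambda>y. y < a) w)"
    by (rule length_filter_less_map) (use Cons.prems in simp)
  moreover have "inv_num (map f w) = inv_num w"
    using Cons by simp
  ultimately show ?case by (simp add: inv_num_Cons)
qed simp

lemma transpose_less_iff:
  fixes p q x y :: int
  assumes "p < q" "x \<notin> {p<..<q}" "y \<notin> {p<..<q}" "\<not> {p, q} \<subseteq> {x, y}"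
  shows "transpose p q x < transpose p q y \<longleftrightarrow> x < y"
  using assms by (auto simp: transpose_def)

lemma length_filter_distinct: "distinct w \<Longrightarrow> length (filter P w) = card {y \<in> set w. P y}"
  by (metis distinct_card distinct_filter set_filter)

text \<open>
  Every pair of positions compares as before, except the one that holds \<open>p\<close> and \<open>q\<close>. Hence the
  two inversion numbers differ by exactly one.
\<close>
lemma inv_num_transpose:
  fixes p q :: int
  assumes "p < q" "distinct w" "p \<in> set w" "q \<in> set w" "set w \<inter> {p<..<q} = {}"
  shows "odd (inv_num (map (transpose p q) w) + inv_num w)"
  using assms(2-)
proof (induction w)
  case (Cons a w)
  have gap: "set w \<inter> {p<..<q} = {}" using Cons.prems by auto
  consider "a = p" | "a = q" | "a \<noteq> p" "a \<noteq> q" by blast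
  then show ?case
  proof cases
    case 1
    then have w: "p \<notin> set w" "q \<in> set w" "distinct w" using Cons.prems \<open>p < q\<close> by auto
    have "transpose p q y < q \<longleftrightarrow> y < p \<or> y = q" if "y \<in> set w" for y
      using that gap \<open>p < q\<close> w by (force simp: transpose_def)
    then have 2: "length (filter (\<lambda>y. y < q) (map (transpose p q) w))
        = card (insert q {y \<in> set w. y < p})"
      using w by (simp add: filter_map o_def length_filter_distinct cong: filter_cong)
        (rule arg_cong[where f = card], auto)
    have 3: "inv_num (map (transpose p q) w) = inv_num w"
      using w gap \<open>p < q\<close> by (intro inv_num_map transpose_less_iff) auto
    have 4: "length (filter (\<lambda>y. y < p) w) = card {y \<in> set w. y < p}"
      using w by (simp add: length_filter_distinct)
    show ?thesis using 1 2 3 4 \<open>p < q\<close> by (simp add: inv_num_Cons)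
  next
    case 2
    then have w: "q \<notin> set w" "p \<in> set w" "distinct w" using Cons.prems \<open>p < q\<close> by auto
    have 3: "inv_num (map (transpose p q) w) = inv_num w"
      using w gap \<open>p < q\<close> by (intro inv_num_map transpose_less_iff) auto
    have "length (filter (\<lambda>y. y < p) (map (transpose p q) w)) = length (filter (\<lambda>y. y < p) w)"
      by (rule length_filter_less_map) (use w gap \<open>p < q\<close> in \<open>force simp: transpose_def\<close>)
    moreover have "{y \<in> set w. y < q} = insert p {y \<in> set w. y < p}"
      using w gap \<open>p < q\<close> by force
    then have "length (filter (\<lambda>y. y < q) w) = Suc (length (filter (\<lambda>y. y < p) w))"
      using w by (simp add: length_filter_distinct)
    ultimately show ?thesis using 2 3 by (simp add: inv_num_Cons)
  next
    case 3
    have "length (filter (\<lambda>y. y < a) (map (transpose p q) w)) = length (filter (\<lambda>y. y < a) w)"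
      by (rule length_filter_less_map) (use Cons.prems 3 \<open>p < q\<close> in \<open>force simp: transpose_def\<close>)
    moreover have "odd (inv_num (map (transpose p q) w) + inv_num w)"
      using Cons 3 by auto
    ultimately show ?thesis using 3 by (simp add: inv_num_Cons)
  qed
qed simp

text \<open>
  Every other letter lies on the same side of \<open>p\<close> and of \<open>q\<close>, so it forms an inversion with both of
  them or with neither.
\<close>
lemma inv_num_insert_pair:
  assumes "p < q" "(set u \<union> set v) \<inter> {p..q} = {}"
  shows "even (inv_num (u @ p # q # v) + inv_num (u @ v))"
  using assms(2)
proof (induction u)
  case Nil
  have "filter (\<lambda>y. y < q) v = filter (\<lambda>y. y < p) v"
    using Nil \<open>p < q\<close> by (intro filter_cong) force+
  then show ?case using \<open>p < q\<close> by (auto simp: inv_num_Cons)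
next
  case (Cons a u)
  have "p < a \<longleftrightarrow> q < a" using Cons.prems \<open>p < q\<close> by auto
  moreover have "even (inv_num (u @ p # q # v) + inv_num (u @ v))" using Cons by auto
  ultimately show ?case by (auto simp: inv_num_Cons)
qed

section \<open>Descents in the flag order\<close>

lemma des_F_Nil [simp]: "des_F [] = 0"
  and des_F_single [simp]: "des_F [a] = 0"
  by (simp_all add: des_F_def)

lemma des_F_Cons:
  "des_F (a # b # w) = (if less_F b a then 1 else 0) + des_F (b # w)"
proof -
  let ?S = "\<lambda>w. {i. Suc i < length w \<and> less_F (w ! Suc i) (w ! i)}"
  have split: "?S (a # b # w) = (if less_F b a then {0} else {}) \<union> Suc ` ?S (b # w)"
    (is "?lhs = ?rhs")
  proof (rule set_eqI)
    fix i show "i \<in> ?lhs \<longleftrightarrow> i \<in> ?rhs"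
      by (cases i) auto
  qed
  have "finite (?S (b # w))" by simp
  then have "card (?S (a # b # w)) = card (if less_F b a then {0::nat} else {}) + card (Suc ` ?S (b # w))"
    unfolding split by (intro card_Un_disjoint) auto
  then show ?thesis unfolding des_F_def by (simp add: card_image)
qed

lemma des_F_append:
  "des_F (u @ a # v) = des_F (u @ [a]) + des_F (a # v)"
proof (induction u rule: induct_list012)
  case (2 x) then show ?case by (simp add: des_F_Cons)
next
  case (3 x y zs) then show ?case by (simp add: des_F_Cons)
qed simp

lemma des_F_map:
  assumes "\<And>i. Suc i < length w \<Longrightarrow> less_F (f (w ! Suc i)) (f (w ! i)) \<longleftrightarrow> less_F (w ! Suc i) (w ! i)"
  shows "des_F (map f w) = des_F w"
  unfolding des_F_def using assms by (intro arg_cong[where f = card]) auto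

section \<open>Signed words over a set of letters\<close>

definition signed_words :: "int set \<Rightarrow> int list set" where
  "signed_words A = {w. distinct (map abs w) \<and> abs ` set w = A}"

text \<open>
  The odd extension of a map on positive letters to signed letters.
\<close>
definition on_abs :: "(int \<Rightarrow> int) \<Rightarrow> int \<Rightarrow> int" where
  "on_abs g x = sgn x * g \<bar>x\<bar>"

text \<open>
  The sign to which only the letters of \<open>P\<close> contribute. For \<open>e = 1\<close> it is the sign of the
  permutation of the absolute values, for \<open>e = -1\<close> each negative letter contributes another \<open>-1\<close>.
  Contracting a pair of letters means removing both from \<open>P\<close>.
\<close>
definition partial_sign :: "int set \<Rightarrow> int poly \<Rightarrow> int list \<Rightarrow> int poly" where
  "partial_sign P e w = (-1) ^ inv_num (filter (\<lambda>x. x \<in> P) (map abs w))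
     * e ^ length (filter (\<lambda>x. x < 0 \<and> \<bar>x\<bar> \<in> P) w)"

lemma signed_perms_eq_signed_words: "signed_perms N = signed_words {1..int N}"
proof -
  have "length w = N" if "distinct (map abs w)" "abs ` set w = {1..int N}" for w :: "int list"
    using distinct_card[OF that(1)] that(2) by simp
  then show ?thesis by (auto simp: signed_perms_def signed_words_def)
qed

lemma finite_signed_words:
  assumes "finite A"
  shows "finite (signed_words A)"
proof (rule finite_subset)
  show "signed_words A \<subseteq> {w. set w \<subseteq> A \<union> uminus ` A \<and> length w \<le> card A}"
  proof clarify
    fix w assume w: "w \<in> signed_words A"
    have "x \<in> A \<union> uminus ` A" if "x \<in> set w" for x
    proof -
      have "\<bar>x\<bar> \<in> A" using that w by (auto simp: signed_words_def)
      then show ?thesis by (cases "x < 0") (auto intro: image_eqI[of _ _ "- x"])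
    qed
    moreover have "length w = card A"
      using distinct_card[of "map abs w"] w by (auto simp: signed_words_def)
    ultimately show "set w \<subseteq> A \<union> uminus ` A \<and> length w \<le> card A" by auto
  qed
  show "finite {w. set w \<subseteq> A \<union> uminus ` A \<and> length w \<le> card A}"
    using assms by (intro finite_lists_length_le) auto
qed

lemma on_abs_simps:
  assumes "g \<bar>x\<bar> > 0"
  shows "x \<noteq> 0 \<Longrightarrow> \<bar>on_abs g x\<bar> = g \<bar>x\<bar>" "on_abs g x < 0 \<longleftrightarrow> x < 0"
  using assms by (auto simp: on_abs_def abs_mult sgn_if)

lemma signed_words_nonzero:
  assumes "w \<in> signed_words A" "A \<subseteq> {1..}" "x \<in> set w"
  shows "\<bar>x\<bar> \<in> A" "x \<noteq> 0"
  using assms by (auto simp: signed_words_def)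

lemma map_abs_on_abs:
  assumes "w \<in> signed_words A" "A \<subseteq> {1..}" "g ` A \<subseteq> {1..}"
  shows "map abs (map (on_abs g) w) = map g (map abs w)"
proof -
  have "\<bar>on_abs g x\<bar> = g \<bar>x\<bar>" if "x \<in> set w" for x
    using signed_words_nonzero[OF assms(1,2) that] assms(3) by (intro on_abs_simps) force+
  then show ?thesis by simp
qed

lemma map_on_abs_in_signed_words:
  assumes "w \<in> signed_words A" "A \<subseteq> {1..}" "B \<subseteq> {1..}" "bij_betw g A B"
  shows "map (on_abs g) w \<in> signed_words B"
proof -
  have gA: "g ` A = B" "inj_on g A" using assms(4) by (auto simp: bij_betw_def)
  have eq: "map abs (map (on_abs g) w) = map g (map abs w)"
    using assms gA by (intro map_abs_on_abs) auto
  have "distinct (map g (map abs w))"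
    using assms(1) gA by (subst distinct_map) (auto simp: signed_words_def)
  moreover have "set (map abs (map (on_abs g) w)) = B"
    unfolding eq using assms(1) gA by (auto simp: signed_words_def image_image)
  ultimately show ?thesis unfolding signed_words_def eq[symmetric] by (simp add: image_image)
qed

lemma map_on_abs_inverse:
  assumes "w \<in> signed_words A" "A \<subseteq> {1..}" "g ` A \<subseteq> {1..}" "\<And>x. x \<in> A \<Longrightarrow> h (g x) = x"
  shows "map (on_abs h) (map (on_abs g) w) = w"
proof -
  have "on_abs h (on_abs g x) = x" if "x \<in> set w" for x
  proof -
    have x: "\<bar>x\<bar> \<in> A" "x \<noteq> 0" using signed_words_nonzero[OF assms(1,2) that] by auto
    then have "g \<bar>x\<bar> > 0" using assms(3) by force
    then show ?thesis using x assms(4)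
      by (cases "x > 0") (auto simp: on_abs_def abs_mult sgn_if)
  qed
  then show ?thesis by (simp add: map_idI)
qed

lemma sum_signed_words_relabel:
  assumes "A \<subseteq> {1..}" "B \<subseteq> {1..}" "bij_betw g A B"
  shows "(\<Sum>w\<in>signed_words B. F w) = (\<Sum>w\<in>signed_words A. F (map (on_abs g) w))"
proof -
  define h where "h = the_inv_into A g"
  have g: "g ` A = B" "inj_on g A" using assms(3) by (auto simp: bij_betw_def)
  have h: "bij_betw h B A" "\<And>x. x \<in> A \<Longrightarrow> h (g x) = x" "\<And>y. y \<in> B \<Longrightarrow> g (h y) = y"
    unfolding h_def using assms(3) g
    by (auto intro: bij_betw_the_inv_into the_inv_into_f_f simp: f_the_inv_into_f_bij_betw)
  then have hB: "h ` B = A" by (simp add: bij_betw_def)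
  show ?thesis
  proof (rule sum.reindex_bij_witness[of _ "map (on_abs g)" "map (on_abs h)"])
    fix w assume "w \<in> signed_words B"
    then show "map (on_abs g) (map (on_abs h) w) = w" "map (on_abs h) w \<in> signed_words A"
      "F (map (on_abs g) (map (on_abs h) w)) = F w"
      using h hB assms map_on_abs_inverse[of w B h g] map_on_abs_in_signed_words[of w B A h] by auto
  next
    fix w assume "w \<in> signed_words A"
    then show "map (on_abs h) (map (on_abs g) w) = w" "map (on_abs g) w \<in> signed_words B"
      using h g assms map_on_abs_inverse[of w A g h] map_on_abs_in_signed_words[of w A B g] by auto
  qed
qed

lemma less_F_on_abs:
  assumes "g \<bar>a\<bar> > 0" "g \<bar>b\<bar> > 0" "a \<noteq> 0" "b \<noteq> 0"
    and "(a < 0) = (b < 0) \<Longrightarrow> g \<bar>b\<bar> < g \<bar>a\<bar> \<longleftrightarrow> \<bar>b\<bar> < \<bar>a\<bar>"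
  shows "less_F (on_abs g b) (on_abs g a) \<longleftrightarrow> less_F b a"
  using assms on_abs_simps[of g a] on_abs_simps[of g b] by (auto simp: less_F_def)

text \<open>
  The flag order compares first the signs and then the absolute values, so it is respected by
  every increasing renaming of the absolute values. The word \<open>0 # w\<close> is treated along with \<open>w\<close>:
  in the flag order 0 lies between the negative and the positive letters, so its descents are those
  of \<open>w\<close> and one more if \<open>w\<close> begins with a negative letter.
\<close>
lemma des_F_on_abs_strict_mono:
  assumes "w \<in> signed_words A" "A \<subseteq> {1..}" "g ` A \<subseteq> {1..}" "strict_mono_on A g"
  shows "des_F (map (on_abs g) w) = des_F w"
    and "des_F (0 # map (on_abs g) w) = des_F (0 # w)"
    and "fdes (map (on_abs g) w) = fdes w"
proof -
  have pos: "\<bar>x\<bar> \<in> A" "x \<noteq> 0" "g \<bar>x\<bar> > 0" if "x \<in> set w" for x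
    using signed_words_nonzero[OF assms(1,2) that] assms(3) by force+
  have "less_F (on_abs g b) (on_abs g a) \<longleftrightarrow> less_F b a" if "a \<in> set w" "b \<in> set w" for a b
    using pos[OF that(1)] pos[OF that(2)] strict_mono_on_less[OF assms(4)]
    by (intro less_F_on_abs) auto
  then show 1: "des_F (map (on_abs g) w) = des_F w" by (intro des_F_map) auto
  show "des_F (0 # map (on_abs g) w) = des_F (0 # w)"
    using 1 pos by (cases w) (auto simp: des_F_Cons less_F_def on_abs_simps)
  have "hd (map (on_abs g) w) < 0 \<longleftrightarrow> hd w < 0"
    using pos by (cases w) (auto simp: on_abs_simps)
  then show "fdes (map (on_abs g) w) = fdes w" by (simp add: fdes_def 1)
qed

section \<open>Contracting two neighbouring letters\<close>

abbreviation swap_abs :: "int \<Rightarrow> int \<Rightarrow> int \<Rightarrow> int" where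
  "swap_abs p q \<equiv> on_abs (transpose p q)"

definition double :: "int \<Rightarrow> int \<Rightarrow> int list \<Rightarrow> int list" where
  "double p q w = concat (map (\<lambda>x. if \<bar>x\<bar> = p then [x, swap_abs p q x] else [x]) w)"

lemma double_split:
  assumes "p \<notin> abs ` set u" "p \<notin> abs ` set v" "\<bar>x\<bar> = p"
  shows "double p q (u @ x # v) = u @ x # swap_abs p q x # v"
proof -
  have id: "concat (map (\<lambda>x. if \<bar>x\<bar> = p then [x, swap_abs p q x] else [x]) w) = w"
    if "p \<notin> abs ` set w" for w
    using that by (induction w) auto
  show ?thesis using assms by (simp add: double_def id)
qed

lemma split_letter:
  assumes "w \<in> signed_words A" "p \<in> A"
  obtains u x v where "w = u @ x # v" "\<bar>x\<bar> = p" "p \<notin> abs ` set u" "p \<notin> abs ` set v"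
proof -
  obtain x where "x \<in> set w" "\<bar>x\<bar> = p" using assms by (auto simp: signed_words_def)
  moreover then obtain u v where "w = u @ x # v" by (meson split_list)
  ultimately show ?thesis using that assms(1) by (force simp: signed_words_def)
qed

locale covering_pair =
  fixes A :: "int set" and p q :: int
  assumes pos: "A \<subseteq> {1..}" and pA: "p \<in> A" and qA: "q \<in> A" and less: "p < q"
    and gap: "A \<inter> {p<..<q} = {}"
begin

abbreviation sw where "sw \<equiv> swap_abs p q"

lemma transpose_bij: "bij_betw (transpose p q) A A"
  using pA qA by (intro bij_betw_byWitness[where f' = "transpose p q"]) (auto simp: transpose_def)

lemma sw_in: "w \<in> signed_words A \<Longrightarrow> map sw w \<in> signed_words A"
  using map_on_abs_in_signed_words[OF _ pos pos transpose_bij] .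

lemma sw_sw: "w \<in> signed_words A \<Longrightarrow> map sw (map sw w) = w"
  using transpose_bij by (intro map_on_abs_inverse[OF _ pos]) (use pos in \<open>auto simp: bij_betw_def\<close>)

lemma abs_sw: "w \<in> signed_words A \<Longrightarrow> map abs (map sw w) = map (transpose p q) (map abs w)"
  using transpose_bij pos by (intro map_abs_on_abs) (auto simp: bij_betw_def)

lemma sw_letter:
  assumes "\<bar>x\<bar> = p"
  shows "\<bar>sw x\<bar> = q" "sw x < 0 \<longleftrightarrow> x < 0" "sw (sw x) = x"
  using assms pos pA qA by (auto simp: on_abs_def sgn_if abs_mult)

lemma sw_sign:
  assumes "\<bar>x\<bar> \<in> A" shows "sw x < 0 \<longleftrightarrow> x < 0"
proof -
  have "transpose p q \<bar>x\<bar> \<in> A" using assms pA qA by (auto simp: transpose_def)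
  then show ?thesis using pos by (intro on_abs_simps) auto
qed

lemma partial_sign_sw:
  assumes "w \<in> signed_words A" "p \<in> P" "q \<in> P"
  shows "partial_sign P e (map sw w) = - partial_sign P e w"
proof -
  let ?f = "filter (\<lambda>x. x \<in> P) (map abs w)"
  have P: "transpose p q y \<in> P \<longleftrightarrow> y \<in> P" for y
    using assms(2,3) by (auto simp: transpose_def)
  have "filter (\<lambda>x. x \<in> P) (map abs (map sw w)) = map (transpose p q) ?f"
    unfolding abs_sw[OF assms(1)] by (simp add: filter_map o_def P)
  moreover have "odd (inv_num (map (transpose p q) ?f) + inv_num ?f)"
    using assms pA qA gap by (intro inv_num_transpose less distinct_filter) (auto simp: signed_words_def)
  moreover have "length (filter (\<lambda>x. x < 0 \<and> \<bar>x\<bar> \<in> P) (map sw w))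
      = length (filter (\<lambda>x. x < 0 \<and> \<bar>x\<bar> \<in> P) w)"
  proof -
    have "sw x < 0 \<and> \<bar>sw x\<bar> \<in> P \<longleftrightarrow> x < 0 \<and> \<bar>x\<bar> \<in> P" if "x \<in> set w" for x
    proof -
      have x: "\<bar>x\<bar> \<in> A" "x \<noteq> 0" using signed_words_nonzero[OF assms(1) pos that] by auto
      then have "\<bar>sw x\<bar> = transpose p q \<bar>x\<bar>"
        using pos pA qA by (intro on_abs_simps) (auto simp: transpose_def)
      then show ?thesis using sw_sign[OF x(1)] P by simp
    qed
    then have "filter ((\<lambda>x. x < 0 \<and> \<bar>x\<bar> \<in> P) \<circ> sw) w = filter (\<lambda>x. x < 0 \<and> \<bar>x\<bar> \<in> P) w"
      by (intro filter_cong) auto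
    then show ?thesis by (simp add: filter_map)
  qed
  ultimately show ?thesis unfolding partial_sign_def
    by (cases "even (inv_num ?f)") auto
qed

text \<open>
  Of two letters that are not \<open>p\<close> and \<open>q\<close> with equal sign, either the signs decide the comparison,
  and these are kept, or at most one absolute value is moved, to a neighbouring value.
\<close>
lemma less_F_sw:
  assumes "\<bar>a\<bar> \<in> A" "\<bar>b\<bar> \<in> A" "\<not> (\<bar>a\<bar> = p \<and> b = sw a)" "\<not> (\<bar>b\<bar> = p \<and> a = sw b)"
  shows "less_F (sw b) (sw a) \<longleftrightarrow> less_F b a"
proof -
  have 1: "\<not> {p, q} \<subseteq> {\<bar>b\<bar>, \<bar>a\<bar>}" if "(a < 0) = (b < 0)"
    using that assms pos pA qA less by (auto simp: on_abs_def sgn_if split: if_splits)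
  have pos': "transpose p q y > 0" "y > 0" if "y \<in> A" for y
    using that pos pA qA by (auto simp: transpose_def)
  show ?thesis
    using 1 pos'[OF assms(1)] pos'[OF assms(2)] gap assms(1,2) less
    by (intro less_F_on_abs transpose_less_iff) auto
qed

text \<open>
  These words and their images under the exchange, which contain \<open>q p\<close> or \<open>(-q) (-p)\<close>, are the only
  ones whose flag descent number the exchange changes.
\<close>
definition doubled where
  "doubled = {w \<in> signed_words A. \<exists>u x v. w = u @ x # sw x # v \<and> \<bar>x\<bar> = p}"

lemma fdes_sw:
  assumes w: "w \<in> signed_words A" "w \<notin> doubled" "map sw w \<notin> doubled"
  shows "fdes (map sw w) = fdes w"
proof -
  have A: "\<bar>x\<bar> \<in> A" if "x \<in> set w" for x using w(1) that by (auto simp: signed_words_def)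
  have "des_F (map sw w) = des_F w"
  proof (rule des_F_map)
    fix i assume i: "Suc i < length w"
    let ?a = "w ! i" and ?b = "w ! Suc i"
    have split: "w = take i w @ ?a # ?b # drop (Suc (Suc i)) w"
      using i by (metis Cons_nth_drop_Suc Suc_lessD append_take_drop_id)
    have "\<not> (\<bar>?a\<bar> = p \<and> ?b = sw ?a)"
      using split w unfolding doubled_def by (metis (mono_tags, lifting) mem_Collect_eq)
    moreover have "\<not> (\<bar>?b\<bar> = p \<and> ?a = sw ?b)"
    proof
      assume *: "\<bar>?b\<bar> = p \<and> ?a = sw ?b"
      have "map sw w = map sw (take i w) @ sw ?a # sw ?b # map sw (drop (Suc (Suc i)) w)"
        using arg_cong[OF split, of "map sw"] by simp
      then have "map sw w = map sw (take i w) @ ?b # sw ?b # map sw (drop (Suc (Suc i)) w)"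
        using * sw_letter(3)[of ?b] by simp
      then show False using w sw_in[OF w(1)] * unfolding doubled_def by blast
    qed
    ultimately show "less_F (sw ?b) (sw ?a) \<longleftrightarrow> less_F ?b ?a"
      using i A by (intro less_F_sw) auto
  qed
  moreover have "hd (map sw w) < 0 \<longleftrightarrow> hd w < 0"
    using A sw_sign by (cases w) auto
  ultimately show ?thesis by (simp add: fdes_def)
qed

text \<open>
  Seen from the other letters, \<open>p\<close> and \<open>q\<close> are indistinguishable, so the block has the same descents
  with its surroundings as the single letter \<open>x\<close>. Inside, \<open>x\<close> followed by the larger absolute value
  is an ascent in the flag order, also when both letters are negative. The sign is that of the word
  without the block, since the block takes part in an even number of inversions and contains zero
  or two negative letters.
\<close>
lemma contract:
  assumes w': "w' \<in> signed_words (A - {q})" "w' = u @ x # v" "\<bar>x\<bar> = p"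
  defines "w \<equiv> u @ x # sw x # v"
  shows "w \<in> signed_words A" "fdes w = fdes w'" "fdes (map sw w) = fdes w' + 2"
    and "p \<in> P \<Longrightarrow> q \<in> P \<Longrightarrow> e ^ 2 = 1 \<Longrightarrow> partial_sign P e w = partial_sign (P - {p, q}) e w'"
proof -
  have uv: "q \<notin> abs ` set u" "q \<notin> abs ` set v" "p \<notin> abs ` set u" "p \<notin> abs ` set v"
      "abs ` set u \<subseteq> A" "abs ` set v \<subseteq> A"
    using w' by (auto simp: signed_words_def)
  note sx = sw_letter[OF w'(3)]
  have pq: "p > 0" "q > 0" using pos pA qA by auto
  have dist: "distinct (map abs w')" and set: "abs ` set w' = A - {q}"
    using w'(1) by (auto simp: signed_words_def)
  have "distinct (map abs w)"
    using dist uv less unfolding w_def w'(2) by (auto simp: sx(1) w'(3))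
  moreover have "abs ` set w = A"
    using set qA unfolding w_def w'(2) by (auto simp: sx(1) w'(3))
  ultimately show wA: "w \<in> signed_words A" by (simp add: signed_words_def)
  have gapuv: "\<bar>y\<bar> < p \<or> q < \<bar>y\<bar>" "\<bar>y\<bar> \<in> A" if "y \<in> set u \<or> y \<in> set v" for y
  proof -
    show "\<bar>y\<bar> \<in> A" using that uv by auto
    moreover have "\<bar>y\<bar> \<noteq> p" "\<bar>y\<bar> \<noteq> q" using that uv by auto
    ultimately show "\<bar>y\<bar> < p \<or> q < \<bar>y\<bar>" using gap less by force
  qed
  have cmp: "less_F y (sw x) \<longleftrightarrow> less_F y x" "less_F (sw x) y \<longleftrightarrow> less_F x y"
    if "y \<in> set u \<or> y \<in> set v" for y
    using gapuv[OF that] sx w'(3) less pq by (auto simp: less_F_def)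
  have sw_uv: "map sw u = u" "map sw v = v"
  proof -
    have "sw y = y" if "y \<in> set u \<or> y \<in> set v" for y
      using gapuv[OF that] less by (auto simp: on_abs_def transpose_def sgn_if)
    then show "map sw u = u" "map sw v = v" by (auto intro: map_idI)
  qed
  have des_v: "des_F (sw x # v) = des_F (x # v)"
    using cmp by (cases v) (auto simp: des_F_Cons)
  have des_u: "des_F (u @ [sw x]) = des_F (u @ [x])"
  proof (cases u rule: rev_cases)
    case (snoc u' c)
    then show ?thesis using des_F_append[of u' c "[sw x]"] des_F_append[of u' c "[x]"] cmp
      by (simp add: des_F_Cons)
  qed simp
  have step: "\<not> less_F (sw x) x" "less_F x (sw x)"
    using sx w'(3) less by (auto simp: less_F_def)
  have "des_F w = des_F w'"
    unfolding w_def w'(2) using des_F_append[of u x "sw x # v"] des_F_append[of u x v] des_v step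
    by (simp add: des_F_Cons)
  moreover have "hd w = hd w'" unfolding w_def w'(2) by (cases u) auto
  ultimately show "fdes w = fdes w'" by (simp add: fdes_def)
  have sww: "map sw w = u @ sw x # x # v" unfolding w_def by (simp add: sw_uv sx)
  have "des_F (map sw w) = des_F w' + 1"
    unfolding sww w'(2) using des_F_append[of u "sw x" "x # v"] des_F_append[of u x v] des_u step
    by (simp add: des_F_Cons)
  moreover have "hd (map sw w) < 0 \<longleftrightarrow> hd w' < 0"
    unfolding sww w'(2) using sx by (cases u) auto
  ultimately show "fdes (map sw w) = fdes w' + 2" by (simp add: fdes_def)
  assume P: "p \<in> P" "q \<in> P" and e: "e ^ 2 = 1"
  let ?F = "\<lambda>l. filter (\<lambda>x. x \<in> P) (map abs l)"
  have F: "filter (\<lambda>x. x \<in> P - {p, q}) (map abs l) = ?F l"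
    "filter (\<lambda>x. x < 0 \<and> \<bar>x\<bar> \<in> P - {p, q}) l = filter (\<lambda>x. x < 0 \<and> \<bar>x\<bar> \<in> P) l"
    if "set l \<subseteq> set u \<union> set v" for l
  proof -
    have "p \<notin> abs ` set l" "q \<notin> abs ` set l" using that uv by blast+
    then show "filter (\<lambda>x. x \<in> P - {p, q}) (map abs l) = ?F l"
      "filter (\<lambda>x. x < 0 \<and> \<bar>x\<bar> \<in> P - {p, q}) l = filter (\<lambda>x. x < 0 \<and> \<bar>x\<bar> \<in> P) l"
      by (auto intro!: filter_cong)
  qed
  have Fw: "?F w = ?F u @ p # q # ?F v"
    unfolding w_def using P by (simp add: sx w'(3))
  have Fw': "filter (\<lambda>x. x \<in> P - {p, q}) (map abs w') = ?F u @ ?F v"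
    using F(1)[of u] F(1)[of v] unfolding w'(2) by (simp add: w'(3))
  have "even (inv_num (?F u @ p # q # ?F v) + inv_num (?F u @ ?F v))"
    using gapuv less by (intro inv_num_insert_pair) force+
  then have i: "(-1::int poly) ^ inv_num (?F w) = (-1) ^ inv_num (filter (\<lambda>x. x \<in> P - {p, q}) (map abs w'))"
    unfolding Fw Fw' by (cases "even (inv_num (?F u @ ?F v))") auto
  have "e * e = 1" using e by (simp add: power2_eq_square)
  then have "e ^ length (filter (\<lambda>x. x < 0 \<and> \<bar>x\<bar> \<in> P) w)
      = e ^ length (filter (\<lambda>x. x < 0 \<and> \<bar>x\<bar> \<in> P - {p, q}) w')"
    using F(2)[of u] F(2)[of v] P unfolding w_def w'(2) by (simp add: sx w'(3) power_add)
  then show "partial_sign P e w = partial_sign (P - {p, q}) e w'" unfolding partial_sign_def i by simp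
qed

lemma double_props:
  assumes "w \<in> signed_words (A - {q})"
  shows "double p q w \<in> doubled" "filter (\<lambda>y. \<bar>y\<bar> \<noteq> q) (double p q w) = w"
    and "fdes (double p q w) = fdes w" "fdes (map sw (double p q w)) = fdes w + 2"
    and "p \<in> P \<Longrightarrow> q \<in> P \<Longrightarrow> e ^ 2 = 1 \<Longrightarrow> partial_sign P e (double p q w) = partial_sign (P - {p, q}) e w"
proof -
  have "p \<in> A - {q}" using pA less by auto
  from split_letter[OF assms this] obtain u x v
    where uv: "w = u @ x # v" "\<bar>x\<bar> = p" "p \<notin> abs ` set u" "p \<notin> abs ` set v" by blast
  have d: "double p q w = u @ x # sw x # v" using double_split uv by simp
  note c = contract[OF assms uv(1,2)]
  show "double p q w \<in> doubled" using c(1) uv(2) unfolding doubled_def d by auto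
  show "fdes (double p q w) = fdes w" "fdes (map sw (double p q w)) = fdes w + 2"
    "p \<in> P \<Longrightarrow> q \<in> P \<Longrightarrow> e ^ 2 = 1 \<Longrightarrow> partial_sign P e (double p q w) = partial_sign (P - {p, q}) e w"
    using c(2-4) unfolding d by auto
  have "q \<notin> abs ` set u" "q \<notin> abs ` set v" using assms uv(1) by (auto simp: signed_words_def)
  then have "filter (\<lambda>y. \<bar>y\<bar> \<noteq> q) u = u" "filter (\<lambda>y. \<bar>y\<bar> \<noteq> q) v = v"
    by (auto simp: filter_id_conv)
  then show "filter (\<lambda>y. \<bar>y\<bar> \<noteq> q) (double p q w) = w"
    unfolding d using sw_letter[OF uv(2)] uv(1,2) less by simp
qed

lemma doubled_eq: "doubled = double p q ` signed_words (A - {q})"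
proof
  show "double p q ` signed_words (A - {q}) \<subseteq> doubled" using double_props(1) by auto
  show "doubled \<subseteq> double p q ` signed_words (A - {q})"
  proof
    fix w assume "w \<in> doubled"
    then obtain u x v where w: "w \<in> signed_words A" "w = u @ x # sw x # v" "\<bar>x\<bar> = p"
      by (auto simp: doubled_def)
    have "p \<notin> abs ` set u" "p \<notin> abs ` set v"
      using w(1) unfolding w(2) by (auto simp: signed_words_def w(3))
    then have "w = double p q (u @ x # v)" using double_split w by simp
    moreover have "u @ x # v \<in> signed_words (A - {q})"
      using w(1) less unfolding w(2) by (auto simp: signed_words_def w(3) sw_letter[OF w(3)])
    ultimately show "w \<in> double p q ` signed_words (A - {q})" by blast
  qed
qed

text \<open>
  The order in which \<open>p\<close> and \<open>q\<close> occur tells the two kinds of blocks apart, so that a word with a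
  block is never counted twice.
\<close>
lemma doubled_order:
  assumes "w \<in> doubled"
  shows "filter (\<lambda>y. y \<in> {p, q}) (map abs w) = [p, q]"
    and "filter (\<lambda>y. y \<in> {p, q}) (map abs (map sw w)) = [q, p]"
proof -
  obtain u x v where w: "w \<in> signed_words A" "w = u @ x # sw x # v" "\<bar>x\<bar> = p"
    using assms by (auto simp: doubled_def)
  have "p \<notin> abs ` set u" "p \<notin> abs ` set v" "q \<notin> abs ` set u" "q \<notin> abs ` set v"
    using w(1) unfolding w(2) by (auto simp: signed_words_def w(3) sw_letter[OF w(3)])
  then have "filter (\<lambda>y. y \<in> {p, q}) (map abs u) = []" "filter (\<lambda>y. y \<in> {p, q}) (map abs v) = []"
    by (auto simp: filter_empty_conv)
  then show 1: "filter (\<lambda>y. y \<in> {p, q}) (map abs w) = [p, q]"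
    using w(3) by (simp add: w(2) sw_letter[OF w(3)])
  have "transpose p q y \<in> {p, q} \<longleftrightarrow> y \<in> {p, q}" for y by (auto simp: transpose_def)
  then have "filter (\<lambda>y. y \<in> {p, q}) (map (transpose p q) (map abs w))
      = map (transpose p q) (filter (\<lambda>y. y \<in> {p, q}) (map abs w))"
    unfolding filter_map o_def by simp
  then show "filter (\<lambda>y. y \<in> {p, q}) (map abs (map sw w)) = [q, p]"
    unfolding abs_sw[OF w(1)] 1 by simp
qed

text \<open>
  Off the blocks, the exchange is an involution that negates the summand, so this part of the sum
  vanishes. A doubled word together with its exchanged partner contributes \<open>1 - t\<^sup>2\<close> times the
  summand of the contracted word.
\<close>
lemma contract_pair:
  assumes "finite A" "p \<in> P" "q \<in> P" "e ^ 2 = 1"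
  shows "(\<Sum>w\<in>signed_words A. partial_sign P e w * t ^ fdes w)
    = (1 - t ^ 2) * (\<Sum>w\<in>signed_words (A - {q}). partial_sign (P - {p, q}) e w * t ^ fdes w)"
proof -
  define W where "W = (\<lambda>w. partial_sign P e w * t ^ fdes w)"
  let ?D = doubled and ?D' = "map sw ` doubled"
  let ?R = "signed_words A - (?D \<union> ?D')"
  have fin: "finite (signed_words A)" using assms(1) by (rule finite_signed_words)
  have DA: "?D \<subseteq> signed_words A" by (auto simp: doubled_def)
  have D'A: "?D' \<subseteq> signed_words A" using DA sw_in by auto
  have "?D \<inter> ?D' = {}"
  proof (rule ccontr)
    assume "?D \<inter> ?D' \<noteq> {}"
    then obtain w w' where "w \<in> ?D" "w' \<in> ?D" "w = map sw w'" by blast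
    then have "[p, q] = [q, p]" using doubled_order by metis
    then show False using less by simp
  qed
  then have DD': "sum W (?D \<union> ?D') = sum W ?D + sum W ?D'"
    using fin DA D'A by (intro sum.union_disjoint) (auto intro: finite_subset)
  have "sum W ?R = (\<Sum>w\<in>?R. - W w)"
  proof (rule sum.reindex_bij_witness[of _ "map sw" "map sw"])
    fix w assume w: "w \<in> ?R"
    then have wA: "w \<in> signed_words A" by blast
    have swsw: "map sw (map sw w) = w" by (rule sw_sw[OF wA])
    have nD: "map sw w \<notin> ?D"
    proof
      assume "map sw w \<in> ?D"
      then have "map sw (map sw w) \<in> ?D'" by (rule imageI)
      then show False using w unfolding swsw by blast
    qed
    have "map sw w \<notin> ?D'"
    proof
      assume "map sw w \<in> ?D'"
      then obtain w' where w': "w' \<in> ?D" "map sw w = map sw w'" by blast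
      then have "map sw (map sw w') = w'" using DA sw_sw by blast
      then have "w = w'" using swsw w'(2) by metis
      then show False using w w'(1) by blast
    qed
    then have in_R: "map sw w \<in> ?R" using sw_in[OF wA] nD by blast
    show "map sw (map sw w) = w" "map sw (map sw w) = w" by (fact swsw)+
    show "map sw w \<in> ?R" "map sw w \<in> ?R" by (fact in_R)+
    show "- W (map sw w) = W w"
      using partial_sign_sw[OF wA assms(2,3)] fdes_sw[OF wA _ nD] w by (simp add: W_def)
  qed
  then have "2 * sum W ?R = 0" by (simp add: sum_negf)
  then have R: "sum W ?R = 0" by simp
  have inj: "inj_on (map sw) ?D"
    by (rule inj_on_inverseI[where g = "map sw"]) (use sw_sw DA in blast)
  have "sum W (signed_words A) = sum W (?D \<union> ?D') + sum W ?R"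
    using sum.subset_diff[of "?D \<union> ?D'" "signed_words A" W] fin DA D'A by (simp add: add.commute)
  also have "\<dots> = (\<Sum>w\<in>?D. W w + W (map sw w))"
    unfolding R DD' by (simp add: sum.reindex[OF inj] sum.distrib)
  also have "\<dots> = (\<Sum>w\<in>signed_words (A - {q}). W (double p q w) + W (map sw (double p q w)))"
    unfolding doubled_eq
    by (subst sum.reindex) (auto intro!: inj_onI dest: arg_cong[where f = "filter (\<lambda>y. \<bar>y\<bar> \<noteq> q)"] simp: double_props(2))
  also have "\<dots> = (\<Sum>w\<in>signed_words (A - {q}). (1 - t ^ 2) * (partial_sign (P - {p, q}) e w * t ^ fdes w))"
  proof (rule sum.cong[OF refl])
    fix w assume w: "w \<in> signed_words (A - {q})"
    have dA: "double p q w \<in> signed_words A" using double_props(1)[OF w] DA by auto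
    show "W (double p q w) + W (map sw (double p q w))
        = (1 - t ^ 2) * (partial_sign (P - {p, q}) e w * t ^ fdes w)"
      unfolding W_def partial_sign_sw[OF dA assms(2,3)] double_props(3,4)[OF w]
        double_props(5)[OF w assms(2-4)]
      by (simp add: algebra_simps power_add power2_eq_square)
  qed
  finally show ?thesis unfolding W_def by (simp add: sum_distrib_left)
qed

end

text \<open>
  Contracting \<open>2k\<close> and \<open>2k + 1\<close> leaves the letter \<open>2k\<close>, which no longer carries a sign. Thus after
  some steps the letters are \<open>1, \<dots>, 2k + 1\<close>, which carry signs, and \<open>2k + 2, 2k + 4, \<dots>, 2n\<close>,
  which do not.
\<close>
lemma contract_all_pairs:
  assumes "e ^ 2 = 1" "k \<le> n"
  shows "(\<Sum>w\<in>signed_words ({1..2 * int k + 1} \<union> (*) 2 ` {int k + 1..int n}).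
            partial_sign {1..2 * int k + 1} e w * t ^ fdes w)
       = (1 - t ^ 2) ^ k * (\<Sum>w\<in>signed_words (insert 1 ((*) 2 ` {1..int n})). partial_sign {1} e w * t ^ fdes w)"
  using assms(2)
proof (induction k)
  case (Suc k)
  let ?A = "\<lambda>k. {1..2 * int k + 1} \<union> (*) 2 ` {int k + 1..int n}"
  let ?p = "2 * int k + 2" and ?q = "2 * int k + 3"
  have evens_gt: "(*) 2 ` {int (Suc k) + 1..int n} \<subseteq> {?q<..}" by auto
  interpret covering_pair "?A (Suc k)" ?p ?q
  proof
    show "?A (Suc k) \<inter> {?p<..<?q} = {}" by auto
  qed auto
  have A: "?A (Suc k) - {?q} = ?A k"
  proof -
    have "(*) 2 ` {int k + 1..int n} = insert ?p ((*) 2 ` {int (Suc k) + 1..int n})"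
    proof -
      have "{int k + 1..int n} = insert (int k + 1) {int (Suc k) + 1..int n}"
        using Suc.prems by auto
      then show ?thesis by simp
    qed
    moreover have "{1..2 * int (Suc k) + 1} - {?q} = insert ?p {1..2 * int k + 1}" by auto
    moreover have "(*) 2 ` {int (Suc k) + 1..int n} - {?q} = (*) 2 ` {int (Suc k) + 1..int n}"
      using evens_gt by auto
    ultimately show ?thesis by (simp only: Un_Diff Un_insert_left Un_insert_right)
  qed
  have P: "{1..2 * int (Suc k) + 1} - {?p, ?q} = {1..2 * int k + 1}" by auto
  have fin: "finite (?A (Suc k))" and pq: "?p \<in> {1..2 * int (Suc k) + 1}" "?q \<in> {1..2 * int (Suc k) + 1}"
    by auto
  have IH: "(\<Sum>w\<in>signed_words (?A k). partial_sign {1..2 * int k + 1} e w * t ^ fdes w) = (1 - t ^ 2) ^ k *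
      (\<Sum>w\<in>signed_words (insert 1 ((*) 2 ` {1..int n})). partial_sign {1} e w * t ^ fdes w)"
    by (rule Suc.IH) (use Suc.prems in simp)
  show ?case
    unfolding contract_pair[OF fin pq assms(1)] A P IH power_Suc mult.assoc ..
qed simp

section \<open>The sign of the type B length\<close>

text \<open>
  Passing to absolute values changes the comparison of two letters exactly if the one with the larger
  absolute value is negative. The sum counts these pairs.
\<close>
lemma inv_num_abs_parity:
  assumes "distinct (map abs w)" "0 \<notin> set w"
  shows "even (inv_num w + inv_num (map abs w)
    + (\<Sum>x | x \<in> set w \<and> x < 0. card {y \<in> set w. \<bar>y\<bar> < \<bar>x\<bar>}))"
  using assms
proof (induction w)
  case (Cons a w)
  let ?N = "{x. x \<in> set w \<and> x < 0}"
  let ?h = "card {x \<in> set w. x < 0 \<and> \<bar>a\<bar> < \<bar>x\<bar>}" and ?l = "card {y \<in> set w. \<bar>y\<bar> < \<bar>a\<bar>}"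
  let ?S = "\<lambda>w. \<Sum>x | x \<in> set w \<and> x < 0. card {y \<in> set w. \<bar>y\<bar> < \<bar>x\<bar>}"
  have dist: "distinct w" "distinct (map abs w)" "a \<notin> set w" "\<bar>a\<bar> \<notin> abs ` set w"
    using Cons.prems by (auto simp: distinct_map)
  have IH: "even (inv_num w + inv_num (map abs w) + ?S w)" using Cons by auto
  have abs_le: "length (filter (\<lambda>y. y < \<bar>a\<bar>) (map abs w)) = ?l"
    using length_filter_distinct[OF dist(1)] by (simp add: filter_map o_def)
  \<comment> \<open>A positive \<open>a\<close> exceeds all letters of smaller absolute value, a negative \<open>a\<close> none of them.
    The negative letters of larger absolute value are smaller than \<open>a\<close> in both cases.\<close>
  have le: "length (filter (\<lambda>y. y < a) w) = ?h + (if a < 0 then 0 else ?l)"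
  proof (cases "a < 0")
    case True
    have "{y \<in> set w. y < a} = {x \<in> set w. x < 0 \<and> \<bar>a\<bar> < \<bar>x\<bar>}" using True by auto
    then show ?thesis using True length_filter_distinct[OF dist(1)] by simp
  next
    case False
    have un: "{y \<in> set w. y < a} = {x \<in> set w. x < 0 \<and> \<bar>a\<bar> < \<bar>x\<bar>} \<union> {y \<in> set w. \<bar>y\<bar> < \<bar>a\<bar>}"
    proof -
      have "y < a \<longleftrightarrow> y < 0 \<and> \<bar>a\<bar> < \<bar>y\<bar> \<or> \<bar>y\<bar> < \<bar>a\<bar>" if "y \<in> set w" for y
      proof -
        have "\<bar>y\<bar> \<noteq> \<bar>a\<bar>" using that dist(4) by (metis imageI)
        then show ?thesis using False by arith
      qed
      then show ?thesis by blast
    qed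
    have "card ({x \<in> set w. x < 0 \<and> \<bar>a\<bar> < \<bar>x\<bar>} \<union> {y \<in> set w. \<bar>y\<bar> < \<bar>a\<bar>}) = ?h + ?l"
      by (rule card_Un_disjoint) auto
    then show ?thesis
      using False by (simp only: length_filter_distinct[OF dist(1)] un if_False)
  qed
  have S: "?S (a # w) = ?S w + ?h + (if a < 0 then ?l else 0)"
  proof -
    have old: "card {y \<in> set (a # w). \<bar>y\<bar> < \<bar>x\<bar>}
        = card {y \<in> set w. \<bar>y\<bar> < \<bar>x\<bar>} + (if \<bar>a\<bar> < \<bar>x\<bar> then 1 else 0)" for x
    proof (cases "\<bar>a\<bar> < \<bar>x\<bar>")
      case True
      then have "{y \<in> set (a # w). \<bar>y\<bar> < \<bar>x\<bar>} = insert a {y \<in> set w. \<bar>y\<bar> < \<bar>x\<bar>}" by auto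
      then show ?thesis using True dist(3) by simp
    next
      case False
      then have "{y \<in> set (a # w). \<bar>y\<bar> < \<bar>x\<bar>} = {y \<in> set w. \<bar>y\<bar> < \<bar>x\<bar>}" by auto
      then show ?thesis using False by simp
    qed
    have "(\<Sum>x\<in>?N. card {y \<in> set (a # w). \<bar>y\<bar> < \<bar>x\<bar>}) = ?S w + (\<Sum>x\<in>?N. if \<bar>a\<bar> < \<bar>x\<bar> then 1 else 0)"
      unfolding old by (simp add: sum.distrib)
    also have "(\<Sum>x\<in>?N. if \<bar>a\<bar> < \<bar>x\<bar> then 1 else 0) = ?h"
      by (subst sum.inter_filter[symmetric]) (auto intro: arg_cong[where f = card])
    finally have N: "(\<Sum>x\<in>?N. card {y \<in> set (a # w). \<bar>y\<bar> < \<bar>x\<bar>}) = ?S w + ?h" .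
    show ?thesis
    proof (cases "a < 0")
      case True
      have "{x. x \<in> set (a # w) \<and> x < 0} = insert a ?N" using True by auto
      then have "?S (a # w) = card {y \<in> set (a # w). \<bar>y\<bar> < \<bar>a\<bar>} + (?S w + ?h)"
        using N dist(3) by simp
      then show ?thesis using True unfolding old by simp
    next
      case False
      then have "{x. x \<in> set (a # w) \<and> x < 0} = ?N" by auto
      then show ?thesis using N False by simp
    qed
  qed
  \<comment> \<open>With \<open>h\<close> and \<open>l\<close> for the cardinalities above, every new pair is counted twice or not at all.\<close>
  have parity: "even ((h + (if c then 0 else l) + i) + (l + j) + (s + h + (if c then l else 0)))"
    if "even (i + j + s)" for h l i j s :: nat and c
    using that by auto
  have cons: "inv_num (a # w) = ?h + (if a < 0 then 0 else ?l) + inv_num w"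
    "inv_num (map abs (a # w)) = ?l + inv_num (map abs w)"
    by (simp_all only: inv_num_Cons le abs_le list.map)
  show ?case unfolding S cons by (rule parity[OF IH])
qed simp

text \<open>
  In a word with absolute values \<open>1, \<dots>, N\<close>, a negative letter \<open>x\<close> has \<open>\<bar>x\<bar> - 1\<close> letters of
  smaller absolute value. So the sum of the absolute values of the negative letters in the type B
  length is their number plus the correction term of \<open>inv_num_abs_parity\<close>.
\<close>
lemma length_B_sign:
  assumes w: "w \<in> signed_words {1..int N}"
  shows "(-1) ^ length_B w = partial_sign {1..int N} (-1) w"
proof -
  have dist: "distinct (map abs w)" "distinct w" "inj_on abs (set w)"
    and A: "abs ` set w = {1..int N}"
    using w by (auto simp: signed_words_def distinct_map)
  have nz: "0 \<notin> set w" using A by force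
  let ?N = "{x. x \<in> set w \<and> x < 0}"
  have "(\<Sum>i | i < length w \<and> w ! i < 0. w ! i) = \<Sum>?N"
    by (rule sum.reindex_bij_betw, rule bij_betw_imageI)
       (use dist(2) in \<open>auto simp: inj_on_def nth_eq_iff_index_eq in_set_conv_nth\<close>)
  then have "int (length_B w) = int (inv_num w) + (\<Sum>x\<in>?N. - x)"
    using int_length_B[of w] by (simp add: sum_negf)
  also have "(\<Sum>x\<in>?N. - x) = (\<Sum>x\<in>?N. 1 + int (card {y \<in> set w. \<bar>y\<bar> < \<bar>x\<bar>}))"
  proof (rule sum.cong[OF refl])
    fix x assume x: "x \<in> ?N"
    then have "\<bar>x\<bar> \<in> {1..int N}" using A by blast
    moreover have "abs ` {y \<in> set w. \<bar>y\<bar> < \<bar>x\<bar>} = {z \<in> abs ` set w. z < \<bar>x\<bar>}" by auto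
    ultimately have "abs ` {y \<in> set w. \<bar>y\<bar> < \<bar>x\<bar>} = {1..<\<bar>x\<bar>}" unfolding A by auto
    then have "card {y \<in> set w. \<bar>y\<bar> < \<bar>x\<bar>} = card {1..<\<bar>x\<bar>}"
      using dist(3) by (metis (no_types, lifting) card_image inj_on_subset mem_Collect_eq subsetI)
    then show "- x = 1 + int (card {y \<in> set w. \<bar>y\<bar> < \<bar>x\<bar>})" using x by simp
  qed
  finally have "length_B w = inv_num w + card ?N + (\<Sum>x\<in>?N. card {y \<in> set w. \<bar>y\<bar> < \<bar>x\<bar>})"
    by (simp add: sum.distrib flip: of_nat_sum of_nat_add)
  moreover have "card ?N = length (filter (\<lambda>x. x < 0) w)"
    using length_filter_distinct[OF dist(2)] by simp
  ultimately have "even (length_B w + (inv_num (map abs w) + length (filter (\<lambda>x. x < 0) w)))"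
    using inv_num_abs_parity[OF dist(1) nz] by presburger
  then have "(-1::int poly) ^ length_B w = (-1) ^ (inv_num (map abs w) + length (filter (\<lambda>x. x < 0) w))"
    by (metis (no_types, lifting) even_add neg_one_even_power neg_one_odd_power)
  moreover have "filter (\<lambda>x. x \<in> {1..int N}) (map abs w) = map abs w"
    "filter (\<lambda>x. x < 0 \<and> \<bar>x\<bar> \<in> {1..int N}) w = filter (\<lambda>x. x < 0) w"
  proof -
    have in_A: "\<bar>x\<bar> \<in> {1..int N}" if "x \<in> set w" for x using that A by blast
    then show "filter (\<lambda>x. x \<in> {1..int N}) (map abs w) = map abs w"
      by (auto simp only: filter_id_conv list.set_map)
    show "filter (\<lambda>x. x < 0 \<and> \<bar>x\<bar> \<in> {1..int N}) w = filter (\<lambda>x. x < 0) w"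
      by (intro filter_cong refl) (use in_A in blast)
  qed
  ultimately show ?thesis unfolding partial_sign_def by (simp add: power_add)
qed

lemma partial_sign_one:
  assumes w: "w \<in> signed_words A" and "1 \<in> A"
  shows "partial_sign {1} e w = (if -1 \<in> set w then e else 1)"
proof -
  obtain u x v where uv: "w = u @ x # v" "\<bar>x\<bar> = 1" "1 \<notin> abs ` set u" "1 \<notin> abs ` set v"
    using split_letter[OF assms] .
  have n1: "-1 \<notin> set u" "-1 \<notin> set v" using uv(3,4) by (force simp: image_iff)+
  have e: "filter (\<lambda>y. y \<in> {1}) (map abs u) = []" "filter (\<lambda>y. y \<in> {1}) (map abs v) = []"
    "filter (\<lambda>x. x < 0 \<and> \<bar>x\<bar> \<in> {1}) u = []" "filter (\<lambda>x. x < 0 \<and> \<bar>x\<bar> \<in> {1}) v = []"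
    using uv(3,4) by (auto simp: filter_empty_conv image_iff)
  have x: "x = 1 \<or> x = -1" using uv(2) by auto
  show ?thesis unfolding partial_sign_def uv(1) using x e n1 by (auto simp: inv_num_Cons)
qed

section \<open>Inserting the smallest letter\<close>

definition insert_at :: "nat \<Rightarrow> int \<Rightarrow> int list \<Rightarrow> int list" where
  "insert_at i x u = take i u @ x # drop i u"

lemma sum_signed_words_insert:
  assumes "finite A" "a > 0" "a \<notin> A"
  shows "(\<Sum>w\<in>signed_words (insert a A). F w)
    = (\<Sum>u\<in>signed_words A. \<Sum>i\<le>length u. F (insert_at i a u) + F (insert_at i (- a) u))"
proof -
  let ?S = "SIGMA u:signed_words A. {..length u} \<times> {a, - a}"
  have free: "a \<notin> abs ` set u" if "u \<in> signed_words A" for u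
    using that assms(3) by (auto simp: signed_words_def)
  have "(\<Sum>w\<in>signed_words (insert a A). F w) = (\<Sum>(u, i, x)\<in>?S. F (insert_at i x u))"
  proof (rule sum.reindex_bij_witness[of _ "\<lambda>(u, i, x). insert_at i x u"
        "\<lambda>w. (filter (\<lambda>y. \<bar>y\<bar> \<noteq> a) w, length (takeWhile (\<lambda>y. \<bar>y\<bar> \<noteq> a) w),
              w ! length (takeWhile (\<lambda>y. \<bar>y\<bar> \<noteq> a) w))"])
    fix w assume w: "w \<in> signed_words (insert a A)"
    obtain u x v where uv: "w = u @ x # v" "\<bar>x\<bar> = a" "a \<notin> abs ` set u" "a \<notin> abs ` set v"
      using split_letter[OF w, of a] by auto
    have f: "filter (\<lambda>y. \<bar>y\<bar> \<noteq> a) u = u" "filter (\<lambda>y. \<bar>y\<bar> \<noteq> a) v = v"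
        "takeWhile (\<lambda>y. \<bar>y\<bar> \<noteq> a) (u @ x # v) = u"
    proof -
      have "\<bar>y\<bar> \<noteq> a" if "y \<in> set u \<union> set v" for y using that uv(3,4) by auto
      then show "filter (\<lambda>y. \<bar>y\<bar> \<noteq> a) u = u" "filter (\<lambda>y. \<bar>y\<bar> \<noteq> a) v = v"
          "takeWhile (\<lambda>y. \<bar>y\<bar> \<noteq> a) (u @ x # v) = u"
        using uv(2) by (simp_all add: filter_id_conv takeWhile_append2)
    qed
    have "u @ v \<in> signed_words A"
    proof -
      have "abs ` set (u @ x # v) = insert a A" "distinct (map abs (u @ x # v))"
        using w by (simp_all only: uv(1) signed_words_def mem_Collect_eq)
      then have "insert a (abs ` set (u @ v)) = insert a A" and dist: "distinct (map abs (u @ v))"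
        by (simp_all add: uv(2) image_Un)
      moreover have "a \<notin> abs ` set (u @ v)" using uv(3,4) by auto
      ultimately have "abs ` set (u @ v) = A" using assms(3) by (metis insert_ident)
      then show ?thesis using dist by (simp add: signed_words_def)
    qed
    moreover have "x = a \<or> x = - a" using uv(2) by auto
    ultimately show "(case (filter (\<lambda>y. \<bar>y\<bar> \<noteq> a) w, length (takeWhile (\<lambda>y. \<bar>y\<bar> \<noteq> a) w),
              w ! length (takeWhile (\<lambda>y. \<bar>y\<bar> \<noteq> a) w)) of (u, i, x) \<Rightarrow> insert_at i x u) = w"
      "(filter (\<lambda>y. \<bar>y\<bar> \<noteq> a) w, length (takeWhile (\<lambda>y. \<bar>y\<bar> \<noteq> a) w),
              w ! length (takeWhile (\<lambda>y. \<bar>y\<bar> \<noteq> a) w)) \<in> ?S"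
      "(case (filter (\<lambda>y. \<bar>y\<bar> \<noteq> a) w, length (takeWhile (\<lambda>y. \<bar>y\<bar> \<noteq> a) w),
              w ! length (takeWhile (\<lambda>y. \<bar>y\<bar> \<noteq> a) w)) of (u, i, x) \<Rightarrow> F (insert_at i x u)) = F w"
      using f uv(1,2) by (auto simp: insert_at_def)
  next
    fix z assume "z \<in> ?S"
    then obtain u i x where z: "z = (u, i, x)" "u \<in> signed_words A" "i \<le> length u" "\<bar>x\<bar> = a"
      using assms(2) by auto
    have td: "a \<notin> abs ` set (take i u)" "a \<notin> abs ` set (drop i u)"
      using free[OF z(2)] by (auto dest: in_set_takeD in_set_dropD)
    have f: "filter (\<lambda>y. \<bar>y\<bar> \<noteq> a) (take i u) = take i u" "filter (\<lambda>y. \<bar>y\<bar> \<noteq> a) (drop i u) = drop i u"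
        "takeWhile (\<lambda>y. \<bar>y\<bar> \<noteq> a) (take i u @ x # drop i u) = take i u"
    proof -
      have "\<bar>y\<bar> \<noteq> a" if "y \<in> set (take i u) \<union> set (drop i u)" for y using that td by auto
      then show "filter (\<lambda>y. \<bar>y\<bar> \<noteq> a) (take i u) = take i u"
          "filter (\<lambda>y. \<bar>y\<bar> \<noteq> a) (drop i u) = drop i u"
          "takeWhile (\<lambda>y. \<bar>y\<bar> \<noteq> a) (take i u @ x # drop i u) = take i u"
        using z(4) by (simp_all add: filter_id_conv takeWhile_append2)
    qed
    show "(filter (\<lambda>y. \<bar>y\<bar> \<noteq> a) (case z of (u, i, x) \<Rightarrow> insert_at i x u),
        length (takeWhile (\<lambda>y. \<bar>y\<bar> \<noteq> a) (case z of (u, i, x) \<Rightarrow> insert_at i x u)),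
        (case z of (u, i, x) \<Rightarrow> insert_at i x u) !
          length (takeWhile (\<lambda>y. \<bar>y\<bar> \<noteq> a) (case z of (u, i, x) \<Rightarrow> insert_at i x u))) = z"
      using f z(3,4) by (simp add: z(1) insert_at_def nth_append)
    have "distinct (map abs (take i u @ drop i u))" "abs ` set (take i u @ drop i u) = A"
      using z(2) by (simp_all add: signed_words_def)
    then show "(case z of (u, i, x) \<Rightarrow> insert_at i x u) \<in> signed_words (insert a A)"
      using td z(4) by (auto simp: z(1) insert_at_def signed_words_def image_Un simp del: append_take_drop_id)
  qed
  also have "\<dots> = (\<Sum>u\<in>signed_words A. \<Sum>i\<le>length u. \<Sum>x\<in>{a, - a}. F (insert_at i x u))"
    using finite_signed_words[OF assms(1)] by (simp add: sum.Sigma sum.cartesian_product)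
  finally show ?thesis using assms(2) by simp
qed

text \<open>
  Insert 1 or \<open>-1\<close> somewhere behind \<open>c\<close>. Between two neighbours of the same sign, or behind a final
  positive letter, both choices produce the same number of descents and cancel. Between a negative and
  a positive letter, or behind a final negative letter, the choice 1 adds no descent and \<open>-1\<close> adds
  one. Between a positive and a negative letter, it is the other way round: 1 adds one and \<open>-1\<close> none.
  The places of the last two kinds alternate and end with a change from negative to positive, if the
  end of the word counts as positive. So everything cancels if \<open>c\<close> is positive, and one contribution
  survives if \<open>c\<close> is negative.
\<close>
lemma sum_insert_after:
  fixes t :: "'a::comm_ring_1"
  assumes "\<bar>c\<bar> > 1" "\<And>x. x \<in> set v \<Longrightarrow> \<bar>x\<bar> > 1"
  shows "(\<Sum>i\<le>length v. t ^ (2 * des_F (c # insert_at i 1 v)) - t ^ (2 * des_F (c # insert_at i (-1) v)))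
     = (if c < 0 then (1 - t ^ 2) * t ^ (2 * des_F (c # v)) else 0)"
  using assms
proof (induction v arbitrary: c)
  case Nil
  then show ?case by (auto simp: insert_at_def des_F_Cons less_F_def)
next
  case (Cons b v)
  let ?d = "\<lambda>v. t ^ (2 * des_F v)"
  have b: "\<bar>b\<bar> > 1" using Cons.prems by simp
  have IH: "(\<Sum>i\<le>length v. ?d (b # insert_at i 1 v) - ?d (b # insert_at i (-1) v))
     = (if b < 0 then (1 - t ^ 2) * ?d (b # v) else 0)"
    using Cons.IH[OF b] Cons.prems by simp
  have shift: "?d (c # b # z) = (if less_F b c then t ^ 2 else 1) * ?d (b # z)" for z
    by (simp add: des_F_Cons power_add)
  have "(\<Sum>i\<le>length (b # v). ?d (c # insert_at i 1 (b # v)) - ?d (c # insert_at i (-1) (b # v)))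
    = ?d (c # 1 # b # v) - ?d (c # -1 # b # v)
      + (\<Sum>i\<le>length v. ?d (c # b # insert_at i 1 v) - ?d (c # b # insert_at i (-1) v))"
    by (simp add: sum.atMost_Suc_shift insert_at_def del: sum.atMost_Suc)
  also have "(\<Sum>i\<le>length v. ?d (c # b # insert_at i 1 v) - ?d (c # b # insert_at i (-1) v))
    = (if less_F b c then t ^ 2 else 1) * (if b < 0 then (1 - t ^ 2) * ?d (b # v) else 0)"
    unfolding shift IH[symmetric] by (simp add: sum_distrib_left right_diff_distrib)
  finally show ?case using Cons.prems(1) b
    by (cases "c < 0"; cases "b < 0")
       (auto simp: des_F_Cons less_F_def power_add algebra_simps power2_eq_square)
qed

text \<open>
  The place in front of the whole word is special, because the first letter decides the parity of the
  flag descent number. Count in units of \<open>t\<close> to the power \<open>2 * des_F u\<close>. If \<open>u\<close> begins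
  with a positive letter, only this place contributes, with \<open>1 - t\<close>. If it begins with a negative letter, the front gives \<open>t\<^sup>2 - t\<close> and the other places
  \<open>t (1 - t\<^sup>2)\<close>, in total \<open>t\<^sup>2 (1 - t)\<close>. The additional \<open>t\<^sup>2\<close> is the descent from 0 to the first
  letter.
\<close>
lemma sum_insert_one:
  fixes t :: "'a::comm_ring_1"
  assumes "\<And>x. x \<in> set u \<Longrightarrow> \<bar>x\<bar> > 1"
  shows "(\<Sum>i\<le>length u. t ^ fdes (insert_at i 1 u) - t ^ fdes (insert_at i (-1) u))
     = (1 - t) * t ^ (2 * des_F (0 # u))"
proof (cases u)
  case Nil
  then show ?thesis by (simp add: insert_at_def fdes_def des_F_Cons)
next
  case (Cons b v)
  let ?d = "\<lambda>v. t ^ (2 * des_F v)"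
  have b: "\<bar>b\<bar> > 1" using assms Cons by simp
  have "(\<Sum>i\<le>length u. t ^ fdes (insert_at i 1 u) - t ^ fdes (insert_at i (-1) u))
    = ?d (1 # b # v) - t * ?d (-1 # b # v)
      + (if b < 0 then t else 1) * (\<Sum>i\<le>length v. ?d (b # insert_at i 1 v) - ?d (b # insert_at i (-1) v))"
    unfolding Cons
    by (simp add: sum.atMost_Suc_shift insert_at_def fdes_def sum_distrib_left right_diff_distrib
        del: sum.atMost_Suc)
  also have "(\<Sum>i\<le>length v. ?d (b # insert_at i 1 v) - ?d (b # insert_at i (-1) v))
     = (if b < 0 then (1 - t ^ 2) * ?d (b # v) else 0)"
    using assms Cons by (intro sum_insert_after) auto
  finally show ?thesis using b unfolding Cons
    by (cases "b < 0") (auto simp: des_F_Cons less_F_def power_add algebra_simps power2_eq_square)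
qed

section \<open>From the flag order to the natural order\<close>

lemma ex_order_reversing_involution:
  fixes S :: "int set"
  assumes "finite S"
  shows "\<exists>r. \<forall>x\<in>S. r x \<in> S \<and> r (r x) = x \<and> (\<forall>y\<in>S. r x < r y \<longleftrightarrow> y < x)"
proof -
  define l where "l = sorted_list_of_set S"
  define m where "m = length l"
  define idx where "idx = the_inv_into {..<m} ((!) l)"
  define r where "r x = l ! (m - 1 - idx x)" for x
  have l: "set l = S" "distinct l" "sorted_wrt (<) l"
    unfolding l_def using assms by auto
  have "inj_on ((!) l) {..<m}" unfolding m_def using l(2) by (intro inj_on_nth) auto
  then have idx: "idx (l ! i) = i" if "i < m" for i
    unfolding idx_def using that by (intro the_inv_into_f_f) auto
  have mono: "l ! i < l ! j \<longleftrightarrow> i < j" if "i < m" "j < m" for i j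
    using sorted_wrt_nth_less[OF l(3), of i j] sorted_wrt_nth_less[OF l(3), of j i] that
    unfolding m_def by (cases i j rule: linorder_cases) auto
  have "r x \<in> S \<and> r (r x) = x \<and> (\<forall>y\<in>S. r x < r y \<longleftrightarrow> y < x)" if "x \<in> S" for x
  proof -
    obtain i where i: "x = l ! i" "i < m"
      using \<open>x \<in> S\<close> unfolding l(1)[symmetric] in_set_conv_nth m_def by blast
    have rx: "r x = l ! (m - 1 - i)" unfolding r_def i(1) idx[OF i(2)] ..
    have "m - 1 - i < m" using i(2) by simp
    then have "r x \<in> S" "r (r x) = x"
      unfolding rx using l(1) i by (auto simp: r_def idx m_def)
    moreover have "r x < r y \<longleftrightarrow> y < x" if "y \<in> S" for y
    proof -
      obtain j where j: "y = l ! j" "j < m"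
        using \<open>y \<in> S\<close> unfolding l(1)[symmetric] in_set_conv_nth m_def by blast
      have "r y = l ! (m - 1 - j)" unfolding r_def j(1) idx[OF j(2)] ..
      then show ?thesis unfolding rx using mono i j by auto
    qed
    ultimately show ?thesis by blast
  qed
  then show ?thesis by blast
qed

text \<open>
  Both orders put the negative letters before 0 and 0 before the positive ones, and they agree on the
  positive letters and are opposite on the negative ones. Reversing the set of negative letters of each
  word turns flag descents into natural descents. The word keeps its letters, only their places change,
  so this is an involution on the words over \<open>A\<close>.
\<close>
lemma sum_des_F_eq_des_B:
  assumes "A \<subseteq> {1..}"
  shows "(\<Sum>w\<in>signed_words A. f (des_F (0 # w))) = (\<Sum>w\<in>signed_words A. f (des_B w))"
proof -
  define rev_on where "rev_on S r \<longleftrightarrow>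
    (\<forall>x\<in>S. r x \<in> S \<and> r (r x) = x \<and> (\<forall>y\<in>S. r x < r y \<longleftrightarrow> y < x))" for S :: "int set" and r
  define r where "r S = (SOME r. rev_on S r)" for S
  have r: "rev_on S (r S)" if "finite S" for S
  proof -
    have "\<exists>r. rev_on S r" unfolding rev_on_def by (rule ex_order_reversing_involution[OF that])
    then show ?thesis unfolding r_def by (rule someI_ex)
  qed
  define neg where "neg w = {x \<in> set w. x < 0}" for w :: "int list"
  define \<phi> where "\<phi> S x = (if x < 0 then r S x else x)" for S x
  define \<Phi> where "\<Phi> w = map (\<phi> (neg w)) w" for w
  have R: "r (neg w) x \<in> neg w" "r (neg w) (r (neg w) x) = x"
    "y \<in> neg w \<Longrightarrow> r (neg w) x < r (neg w) y \<longleftrightarrow> y < x" if "x \<in> neg w" for w x y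
    using r[of "neg w"] that unfolding rev_on_def by (simp_all add: neg_def)
  have \<phi>: "\<phi> (neg w) x \<in> set w" "\<phi> (neg w) (\<phi> (neg w) x) = x" "\<phi> (neg w) x < 0 \<longleftrightarrow> x < 0"
    if "x \<in> set w" for w x
    using that R[of x w] unfolding \<phi>_def by (auto simp: neg_def)
  have set: "set (\<Phi> w) = set w" for w
  proof
    show "set (\<Phi> w) \<subseteq> set w" using \<phi>(1) by (auto simp: \<Phi>_def)
    show "set w \<subseteq> set (\<Phi> w)"
      using \<phi>(1,2) unfolding \<Phi>_def by (auto simp: image_iff) metis
  qed
  then have neg: "neg (\<Phi> w) = neg w" for w by (simp add: neg_def)
  have inv: "\<Phi> (\<Phi> w) = w" for w
  proof -
    have "\<Phi> (\<Phi> w) = map (\<phi> (neg w)) (\<Phi> w)" using neg by (simp add: \<Phi>_def[of "\<Phi> w"])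
    also have "\<dots> = w" using \<phi>(2) by (simp add: \<Phi>_def map_idI)
    finally show ?thesis .
  qed
  have arr: "\<Phi> w \<in> signed_words A" if "w \<in> signed_words A" for w
  proof -
    have "length (\<Phi> w) = length w" by (simp add: \<Phi>_def)
    then have "distinct (\<Phi> w)" using that set[of w] distinct_card[of w]
      by (intro card_distinct) (simp add: signed_words_def distinct_map)
    then show ?thesis using that set[of w] by (simp add: signed_words_def distinct_map)
  qed
  have des: "des_B (\<Phi> w) = des_F (0 # w)" if "w \<in> signed_words A" for w
  proof -
    let ?\<phi> = "\<phi> (neg w)"
    have nz: "0 \<notin> set w" using that assms by (force simp: signed_words_def)
    have less: "?\<phi> b < ?\<phi> a \<longleftrightarrow> less_F b a" if ab: "a \<in> set (0 # w)" "b \<in> set w" for a b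
    proof -
      have "b \<noteq> 0" using nz ab(2) by auto
      then consider "a < 0" "b < 0" | "a < 0" "b > 0" | "a \<ge> 0" "b < 0" | "a \<ge> 0" "b > 0"
        by (meson linorder_less_linear not_less)
      then show ?thesis
      proof cases
        case 1
        then have "a \<in> neg w" "b \<in> neg w" using ab by (auto simp: neg_def)
        then show ?thesis using 1 R(3) by (simp add: \<phi>_def less_F_def)
      next
        case 2
        then have "?\<phi> a < 0" using ab \<phi>(3)[of a w] by auto
        then show ?thesis using 2 by (simp add: \<phi>_def less_F_def)
      next
        case 3
        then have "?\<phi> b < 0" using ab \<phi>(3)[of b w] by auto
        then show ?thesis using 3 by (simp add: \<phi>_def less_F_def)
      next
        case 4
        then show ?thesis by (auto simp: \<phi>_def less_F_def)
      qed
    qed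
    have 0: "0 # \<Phi> w = map ?\<phi> (0 # w)" by (simp add: \<Phi>_def \<phi>_def)
    have len: "length (\<Phi> w) = length w" by (simp add: \<Phi>_def)
    have "(0 # \<Phi> w) ! Suc i < (0 # \<Phi> w) ! i \<longleftrightarrow> less_F ((0 # w) ! Suc i) ((0 # w) ! i)"
      if "i < length w" for i
    proof -
      have "(0 # w) ! i \<in> set (0 # w)" by (rule nth_mem) (use that in simp)
      then show ?thesis unfolding 0 using that less[of "(0 # w) ! i" "w ! i"]
        by (simp add: nth_map[of i "0 # w"] del: list.map)
    qed
    then show ?thesis unfolding des_B_def des_F_def len
      by (intro arg_cong[where f = card]) auto
  qed
  show ?thesis
    by (rule sum.reindex_bij_witness[of _ \<Phi> \<Phi>]) (use inv arr des in auto)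
qed

section \<open>The two identities\<close>

lemma one_notin_evens: "1 \<notin> (*) 2 ` {1..int n}"
  by (auto, presburger)

lemma contract_to_evens:
  assumes "e ^ 2 = 1"
  shows "(\<Sum>w\<in>signed_words {1..int (2 * n + 1)}. partial_sign {1..int (2 * n + 1)} e w * t ^ fdes w)
    = (1 - t ^ 2) ^ n * (\<Sum>w\<in>signed_words (insert 1 ((*) 2 ` {1..int n})). partial_sign {1} e w * t ^ fdes w)"
proof -
  have "{1..2 * int n + 1} \<union> (*) 2 ` {int n + 1..int n} = {1..int (2 * n + 1)}"
    and "2 * int n + 1 = int (2 * n + 1)" by auto
  then show ?thesis using contract_all_pairs[OF assms, of n n t] by (simp only: order_refl)
qed

lemma sum_sign_abs_fdes:
  fixes t :: "int poly"
  shows "(\<Sum>w\<in>signed_perms (2 * n + 1). (-1) ^ inv_num (map abs w) * t ^ fdes w)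
           = (1 - t ^ 2) ^ n * (\<Sum>w\<in>signed_perms (n + 1). t ^ fdes w)"
proof -
  let ?E = "(*) 2 ` {1..int n}" and ?A = "{1..int (2 * n + 1)}"
  \<comment> \<open>The increasing enumeration of \<open>1, 2, 4, \<dots>, 2n\<close>.\<close>
  define g :: "int \<Rightarrow> int" where "g i = (if i = 1 then 1 else 2 * (i - 1))" for i
  have g: "strict_mono_on {1..int (n + 1)} g" by (auto simp: strict_mono_on_def g_def)
  have g_img: "g ` {1..int (n + 1)} = insert 1 ?E"
  proof -
    have "{1..int (n + 1)} = insert 1 ((\<lambda>i. i + 1) ` {1..int n})"
      by (auto simp: image_iff)
    moreover have "(\<lambda>i. g (i + 1)) ` {1..int n} = ?E"
      by (rule image_cong) (auto simp: g_def)
    moreover have "g 1 = 1" by (simp add: g_def)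
    ultimately show ?thesis by (simp only: image_insert image_image)
  qed
  have "(\<Sum>w\<in>signed_perms (2 * n + 1). (-1) ^ inv_num (map abs w) * t ^ fdes w)
      = (\<Sum>w\<in>signed_words ?A. partial_sign ?A 1 w * t ^ fdes w)"
    unfolding signed_perms_eq_signed_words
  proof (rule sum.cong[OF refl])
    fix w assume "w \<in> signed_words ?A"
    then have "filter (\<lambda>x. x \<in> ?A) (map abs w) = map abs w"
      by (auto simp: filter_id_conv signed_words_def simp del: of_nat_add)
    then show "(-1) ^ inv_num (map abs w) * t ^ fdes w = partial_sign ?A 1 w * t ^ fdes w"
      by (simp add: partial_sign_def)
  qed
  also have "\<dots> = (1 - t ^ 2) ^ n * (\<Sum>w\<in>signed_words (insert 1 ?E). t ^ fdes w)"
    unfolding contract_to_evens[OF one_power2] by (simp add: partial_sign_one)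
  also have "(\<Sum>w\<in>signed_words (insert 1 ?E). t ^ fdes w) = (\<Sum>w\<in>signed_perms (n + 1). t ^ fdes w)"
  proof -
    have "bij_betw g {1..int (n + 1)} (insert 1 ?E)"
      using g g_img strict_mono_on_imp_inj_on by (auto simp: bij_betw_def)
    then have "(\<Sum>w\<in>signed_words (insert 1 ?E). t ^ fdes w)
        = (\<Sum>w\<in>signed_words {1..int (n + 1)}. t ^ fdes (map (on_abs g) w))"
      by (intro sum_signed_words_relabel) auto
    also have "\<dots> = (\<Sum>w\<in>signed_perms (n + 1). t ^ fdes w)"
      unfolding signed_perms_eq_signed_words
      by (intro sum.cong refl arg_cong[where f = "(^) t"] des_F_on_abs_strict_mono(3)[OF _ _ _ g])
         (auto simp: g_def)
    finally show ?thesis .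
  qed
  finally show ?thesis .
qed

lemma sum_sign_length_B_fdes:
  fixes t :: "int poly"
  shows "(\<Sum>w\<in>signed_perms (2 * n + 1). (-1) ^ length_B w * t ^ fdes w)
           = (1 - t ^ 2) ^ n * (1 - t) * (\<Sum>w\<in>signed_perms n. t ^ (2 * des_B w))"
proof -
  let ?E = "(*) 2 ` {1..int n}" and ?A = "{1..int (2 * n + 1)}"
  have "(\<Sum>w\<in>signed_perms (2 * n + 1). (-1) ^ length_B w * t ^ fdes w)
      = (\<Sum>w\<in>signed_words ?A. partial_sign ?A (-1) w * t ^ fdes w)"
    unfolding signed_perms_eq_signed_words by (intro sum.cong refl) (simp only: length_B_sign)
  also have "\<dots> = (1 - t ^ 2) ^ n
      * (\<Sum>w\<in>signed_words (insert 1 ?E). (if -1 \<in> set w then -1 else 1) * t ^ fdes w)"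
    by (subst contract_to_evens) (simp_all add: partial_sign_one cong: sum.cong)
  also have "(\<Sum>w\<in>signed_words (insert 1 ?E). (if -1 \<in> set w then -1 else 1) * t ^ fdes w)
      = (\<Sum>u\<in>signed_words ?E. (1 - t) * t ^ (2 * des_F (0 # u)))"
  proof (subst sum_signed_words_insert, simp, simp, rule one_notin_evens, rule sum.cong[OF refl])
    fix u assume u: "u \<in> signed_words ?E"
    have gt: "\<bar>x\<bar> > 1" if "x \<in> set u" for x
      using signed_words_nonzero(1)[OF u _ that] by fastforce
    have "-1 \<notin> set u" using gt by force
    then have "-1 \<notin> set (take i u)" "-1 \<notin> set (drop i u)" for i
      by (auto dest: in_set_takeD in_set_dropD)
    then have "-1 \<notin> set (insert_at i 1 u)" "-1 \<in> set (insert_at i (-1) u)" for i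
      by (auto simp: insert_at_def)
    then show "(\<Sum>i\<le>length u.
          (if -1 \<in> set (insert_at i 1 u) then -1 else 1) * t ^ fdes (insert_at i 1 u)
        + (if -1 \<in> set (insert_at i (-1) u) then -1 else 1) * t ^ fdes (insert_at i (-1) u))
        = (1 - t) * t ^ (2 * des_F (0 # u))"
      using sum_insert_one[OF gt, of u t] by simp
  qed
  also have "\<dots> = (1 - t) * (\<Sum>u\<in>signed_words ?E. t ^ (2 * des_F (0 # u)))"
    by (simp only: sum_distrib_left)
  also have "(\<Sum>u\<in>signed_words ?E. t ^ (2 * des_F (0 # u)))
      = (\<Sum>u\<in>signed_words {1..int n}. t ^ (2 * des_F (0 # map (on_abs ((*) 2)) u)))"
    by (rule sum_signed_words_relabel) (auto simp: bij_betw_def inj_on_def)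
  also have "\<dots> = (\<Sum>u\<in>signed_words {1..int n}. t ^ (2 * des_F (0 # u)))"
    by (intro sum.cong refl arg_cong[where f = "\<lambda>d. t ^ (2 * d)"] des_F_on_abs_strict_mono(2))
       (auto simp: strict_mono_on_def)
  also have "\<dots> = (\<Sum>u\<in>signed_perms n. t ^ (2 * des_B u))"
    unfolding signed_perms_eq_signed_words by (rule sum_des_F_eq_des_B) auto
  finally show ?thesis by (simp only: mult.assoc)
qed

theorem theorem2:
  fixes n :: nat
  assumes "n \<ge> 1"
  shows "(\<Sum>w\<in>signed_perms (2 * n + 1). (-1) ^ inv_num (map abs w) * indet ^ fdes w)
           = (1 - indet ^ 2) ^ n * (\<Sum>w\<in>signed_perms (n + 1). indet ^ fdes w)
       \<and> (\<Sum>w\<in>signed_perms (2 * n + 1). (-1) ^ length_B w * indet ^ fdes w)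
           = (1 - indet ^ 2) ^ n * (1 - indet) * (\<Sum>w\<in>signed_perms n. indet ^ (2 * des_B w))"
  using sum_sign_abs_fdes[of indet n] sum_sign_length_B_fdes[of indet n] by (rule conjI)

end
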